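(* For $\theta>0$ let $\gamma_1(\theta)>\gamma_2(\theta)>\cdots$ be the points, in decreasing order, of the inhomogeneous Poisson point process on $(0,\infty)$ with mean measure $\theta x^{-1}e^{-x}\,dx$, and let $P_\theta$ denote the law of $\theta^{-1}(\gamma_1(\theta),\gamma_2(\theta),\ldots)$ on $\mathbb{R}_+^\infty$. Then, as $\theta\to\infty$, the family $\{P_\theta:\theta>0\}$ satisfies a large deviation principle on $\mathbb{R}_+^\infty$ with speed $\theta$ and good rate function $$I(x_1,x_2,\ldots)=\begin{cases}\displaystyle\sum_{i=1}^\infty x_i, & x_1\ge x_2\ge\cdots\ge 0,\\ \infty, & \text{otherwise.}\end{cases}$$
   Context: $\mathbb{R}_+=[0,\infty)$ and $\mathbb{R}_+^\infty$ is the space of sequences of nonnegative reals with the product topology. A family $\{P_\theta\}$ of Borel probability measures on a space $E$ satisfies a large deviation principle (LDP) as $\theta\to\infty$ with speed $\theta$ and rate function $I:E\to[0,\infty]$ (lower semicontinuous) if for every closed $F\subset E$, $\limsup_{\theta\to\infty}\theta^{-1}\log P_\theta(F)\le-\inf_{x\in F}I(x)$, and for every open $G\subset E$, $\liminf_{\theta\to\infty}\theta^{-1}\log P_\theta(G)\ge-\inf_{x\in G}I(x)$. The rate function is good if $\{x\in E: I(x)\le c\}$ is compact for every $c\ge0$. *)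

theory Defs
  imports "HOL-Probability.Probability"
begin

definition borel_of_topology :: "'a topology \<Rightarrow> 'a measure" where
  "borel_of_topology X = sigma (topspace X) {U. openin X U}"

text \<open>Logarithm of a probability, with \<open>log 0 = -\<infinity>\<close> (the library has \<open>ln 0 = 0\<close>).\<close>
definition log_prob :: "real \<Rightarrow> ereal" where
  "log_prob p = (if p = 0 then -\<infinity> else ereal (ln p))"

definition rate_function :: "'a topology \<Rightarrow> ('a \<Rightarrow> ennreal) \<Rightarrow> bool" where
  "rate_function X I \<longleftrightarrow> (\<forall>c. closedin X {x \<in> topspace X. I x \<le> c})"

definition good_rate_function :: "'a topology \<Rightarrow> ('a \<Rightarrow> ennreal) \<Rightarrow> bool" where
  "good_rate_function X I \<longleftrightarrow> rate_function X I \<and>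
     (\<forall>c::real. 0 \<le> c \<longrightarrow> compactin X {x \<in> topspace X. I x \<le> ennreal c})"

text \<open>Large deviation principle as \<open>\<theta> \<rightarrow> \<infinity>\<close> with speed \<open>\<theta>\<close>, for a family of Borel probability
  measures indexed by \<open>\<theta> > 0\<close>; the values of \<open>P\<close> at \<open>\<theta> \<le> 0\<close> are irrelevant.\<close>
definition large_deviation_principle ::
  "'a topology \<Rightarrow> (real \<Rightarrow> 'a measure) \<Rightarrow> ('a \<Rightarrow> ennreal) \<Rightarrow> bool" where
  "large_deviation_principle X P I \<longleftrightarrow>
     (\<forall>\<theta>>0. prob_space (P \<theta>) \<and> space (P \<theta>) = topspace X \<and>
        sets (P \<theta>) = sets (borel_of_topology X)) \<and>
     rate_function X I \<and>
     (\<forall>F. closedin X F \<longrightarrow>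
        Limsup at_top (\<lambda>\<theta>. ereal (1 / \<theta>) * log_prob (measure (P \<theta>) F))
          \<le> - enn2ereal (INF x\<in>F. I x)) \<and>
     (\<forall>G. openin X G \<longrightarrow>
        - enn2ereal (INF x\<in>G. I x)
          \<le> Liminf at_top (\<lambda>\<theta>. ereal (1 / \<theta>) * log_prob (measure (P \<theta>) G)))"

definition point_count :: "('w \<Rightarrow> 'a set) \<Rightarrow> 'a set \<Rightarrow> 'w \<Rightarrow> ennreal" where
  "point_count \<Xi> A \<omega> = emeasure (count_space UNIV) (\<Xi> \<omega> \<inter> A)"

text \<open>A Poisson point process as a random countable set (appropriate for non-atomic mean
  measures, for which points are almost surely simple).  A set of infinite mean measure almost
  surely contains infinitely many points.\<close>
definition poisson_point_process ::
  "'w measure \<Rightarrow> 'a measure \<Rightarrow> ('w \<Rightarrow> 'a set) \<Rightarrow> bool" where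
  "poisson_point_process W \<mu> \<Xi> \<longleftrightarrow>
     prob_space W \<and>
     (\<forall>\<omega>\<in>space W. countable (\<Xi> \<omega>) \<and> \<Xi> \<omega> \<subseteq> space \<mu>) \<and>
     (\<forall>A\<in>sets \<mu>. point_count \<Xi> A \<in> borel_measurable W) \<and>
     (\<forall>A\<in>sets \<mu>. emeasure \<mu> A < \<infinity> \<longrightarrow>
        (\<forall>k::nat. measure W {\<omega> \<in> space W. point_count \<Xi> A \<omega> = of_nat k}
           = exp (- measure \<mu> A) * measure \<mu> A ^ k / fact k)) \<and>
     (\<forall>A\<in>sets \<mu>. emeasure \<mu> A = \<infinity> \<longrightarrow> (AE \<omega> in W. point_count \<Xi> A \<omega> = \<infinity>)) \<and>
     (\<forall>(A :: nat \<Rightarrow> 'a set) n. (\<forall>i<n. A i \<in> sets \<mu>) \<and> disjoint_family_on A {..<n} \<longrightarrow>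
        prob_space.indep_vars W (\<lambda>_. borel) (\<lambda>i. point_count \<Xi> (A i)) {..<n})"

definition gamma_mean_measure :: "real \<Rightarrow> real measure" where
  "gamma_mean_measure \<theta> =
     density (restrict_space lborel {0<..}) (\<lambda>x. ennreal (\<theta> * inverse x * exp (- x)))"

definition nonneg_sequences :: "(nat \<Rightarrow> real) topology" where
  "nonneg_sequences = product_topology (\<lambda>_. top_of_set {0..}) UNIV"

text \<open>Sequences are indexed from \<open>0\<close>: \<open>x i\<close> stands for the coordinate with number \<open>i + 1\<close>.\<close>
definition ordered_sum_rate :: "(nat \<Rightarrow> real) \<Rightarrow> ennreal" where
  "ordered_sum_rate x =
     (if (\<forall>i. x (Suc i) \<le> x i) \<and> (\<forall>i. 0 \<le> x i) then (\<Sum>i. ennreal (x i)) else \<infinity>)"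

end

theory Submission
  imports Defs
begin

text \<open>For closed \<open>F\<close> and \<open>r\<close> below the infimum of the rate, compactness yields an \<open>n\<close> such that every
  ordered sequence in \<open>F\<close> has its first \<open>n\<close> coordinates summing to more than \<open>r\<close>. Cutting \<open>(0, \<infinity>)\<close> into
  cells of width \<open>\<theta> \<delta>\<close>, there are finitely many ways, independently of \<open>\<theta>\<close>, in which the \<open>n\<close> largest
  points can occupy the cells; a prescribed occupation has probability at most a constant times
  \<open>exp (- \<theta> \<delta> \<Sum> k\<^sub>i)\<close>, with \<open>k\<^sub>i\<close> the cell of the \<open>i\<close>-th point, since a Poisson variable of mean \<open>\<mu>\<close>
  is \<open>\<ge> m\<close> with probability at most \<open>\<mu> ^ m\<close>, and the mean measure of \<open>[\<theta> t, \<infinity>)\<close> is at most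
  \<open>exp (- \<theta> t) / t\<close>.

  For open \<open>G\<close> and \<open>x \<in> G\<close>, shift the first \<open>n\<close> coordinates of \<open>x\<close> slightly to obtain disjoint short
  intervals. With exactly one point in each of them and no further point above a small level, the
  scaled process lies in \<open>G\<close>; this has probability at least a constant times \<open>exp (- \<theta> \<Sum> b\<^sub>i)\<close>, where the
  right endpoints \<open>b\<^sub>i\<close> sum to little more than the rate of \<open>x\<close>.\<close>

subsection \<open>The space of nonnegative sequences and the rate function\<close>

text \<open>Replaces the abstract product topology by a subspace of the type-class topology on
  functions, where \<open>open\<close>, \<open>closed\<close> and \<open>compact\<close> can be used
  directly.\<close>

lemma nonneg_sequences_eq: "nonneg_sequences = top_of_set {x. \<forall>i. 0 \<le> x i}"
proof -
  have "nonneg_sequences = subtopology (product_topology (\<lambda>_. euclidean) UNIV) (PiE UNIV (\<lambda>_. {0..}))"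
    unfolding nonneg_sequences_def by (rule subtopology_product_topology[symmetric])
  also have "PiE UNIV (\<lambda>_::nat. {0::real..}) = {x. \<forall>i. 0 \<le> x i}"
    by (auto simp: PiE_iff)
  finally show ?thesis
    by (simp add: euclidean_product_topology)
qed

lemma topspace_nonneg_sequences: "topspace nonneg_sequences = {x. \<forall>i. 0 \<le> x i}"
  by (simp add: nonneg_sequences_eq)

lemma closed_nonneg_sequences: "closed {x :: nat \<Rightarrow> real. \<forall>i. 0 \<le> x i}"
  by (intro closed_Collect_all closed_Collect_le continuous_on_const continuous_on_product_coordinates)

lemma closedin_nonneg_sequences_iff:
  "closedin nonneg_sequences F \<longleftrightarrow> closed F \<and> F \<subseteq> {x. \<forall>i. 0 \<le> x i}"
  unfolding nonneg_sequences_eq by (rule closedin_closed_eq[OF closed_nonneg_sequences])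

text \<open>A basic product neighbourhood constrains only finitely many coordinates, so one
  tolerance and one initial segment suffice. The lower bound thereby needs to control only the
  \<open>n\<close> largest points.\<close>

lemma openin_nonneg_sequences_contains_box:
  assumes "openin nonneg_sequences G" and "x \<in> G"
  obtains \<epsilon> n where "0 < \<epsilon>"
    and "\<forall>y. (\<forall>i. 0 \<le> y i) \<and> (\<forall>i<n. \<bar>y i - x i\<bar> < \<epsilon>) \<longrightarrow> y \<in> G"
proof -
  obtain T where T: "open T" "G = {x. \<forall>i. 0 \<le> x i} \<inter> T"
    using assms(1) unfolding nonneg_sequences_eq openin_open by blast
  then have "openin (product_topology (\<lambda>_::nat. euclidean::real topology) UNIV) T" "x \<in> T"
    using assms(2) by (auto simp: open_fun_def)
  from product_topology_open_contains_basis[OF this]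
  obtain X :: "nat \<Rightarrow> real set" where X: "x \<in> PiE UNIV X" "\<And>i. open (X i)"
    "finite {i. X i \<noteq> UNIV}" "PiE UNIV X \<subseteq> T"
    by auto
  define J where "J = {i. X i \<noteq> UNIV}"
  have "\<exists>e>0. \<forall>y. \<bar>y - x i\<bar> < e \<longrightarrow> y \<in> X i" for i
    using X(1) X(2)[of i] by (auto simp: PiE_iff open_real)
  then obtain e where e: "\<And>i. 0 < e i" "\<And>i y. \<bar>y - x i\<bar> < e i \<Longrightarrow> y \<in> X i"
    by metis
  \<comment> \<open>The inserted \<open>1\<close> keeps the minimum meaningful when no coordinate is
    constrained.\<close>
  define \<epsilon> where "\<epsilon> = Min (insert 1 (e ` J))"
  have fin: "finite J"
    using X(3) by (simp add: J_def)
  then have \<epsilon>: "0 < \<epsilon>" "\<And>i. i \<in> J \<Longrightarrow> \<epsilon> \<le> e i"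
    using e(1) by (auto simp: \<epsilon>_def)
  obtain n where n: "J \<subseteq> {..<n}"
    using fin finite_nat_bounded by blast
  show thesis
  proof (rule that[OF \<epsilon>(1)], intro allI impI)
    fix y :: "nat \<Rightarrow> real"
    assume "(\<forall>i. 0 \<le> y i) \<and> (\<forall>i<n. \<bar>y i - x i\<bar> < \<epsilon>)"
    then have y: "\<And>i. 0 \<le> y i" "\<And>i. i < n \<Longrightarrow> \<bar>y i - x i\<bar> < \<epsilon>"
      by auto
    have "y i \<in> X i" for i
    proof (cases "i \<in> J")
      case True
      then show ?thesis
        using y(2)[of i] n \<epsilon>(2)[of i] e(2)[of "y i" i] by force
    qed (simp add: J_def)
    then show "y \<in> G"
      using X(4) T(2) y(1) by (auto simp: PiE_iff)
  qed
qed

text \<open>A series of nonnegative terms is the supremum of its partial sums. Sublevel sets thus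
  become intersections of closed conditions on finitely many real coordinates.\<close>

lemma ordered_sum_rate_le_iff:
  assumes "0 \<le> c"
  shows "ordered_sum_rate x \<le> ennreal c \<longleftrightarrow>
    (\<forall>i. x (Suc i) \<le> x i) \<and> (\<forall>i. 0 \<le> x i) \<and> (\<forall>n. (\<Sum>i<n. x i) \<le> c)"
proof (cases "(\<forall>i. x (Suc i) \<le> x i) \<and> (\<forall>i. 0 \<le> x i)")
  case True
  have "(\<Sum>i. ennreal (x i)) \<le> ennreal c \<longleftrightarrow> (\<forall>n. (\<Sum>i<n. ennreal (x i)) \<le> ennreal c)"
    by (simp add: suminf_eq_SUP SUP_le_iff)
  also have "\<dots> \<longleftrightarrow> (\<forall>n. (\<Sum>i<n. x i) \<le> c)"
    using True assms by (simp add: sum_nonneg)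
  finally show ?thesis
    using True by (simp add: ordered_sum_rate_def)
next
  case False
  then show ?thesis
    by (auto simp: ordered_sum_rate_def top_unique)
qed

section \<open>Closedness and compactness of the sublevel sets\<close>

lemma closed_ordered_partial_sum:
  "closed {x :: nat \<Rightarrow> real. (\<forall>i. x (Suc i) \<le> x i) \<and> (\<forall>i. 0 \<le> x i) \<and> (\<Sum>i<n. x i) \<le> c}"
  by (intro closed_Collect_conj closed_Collect_all closed_Collect_le continuous_on_sum
      continuous_on_const continuous_on_product_coordinates)

text \<open>The first coordinate is one of the nonnegative summands and dominates all later
  coordinates, so a bound on a single nonempty partial sum confines the whole sequence to a compact
  box.\<close>

lemma ordered_partial_sum_subset:
  assumes "0 < n"
  shows "{x :: nat \<Rightarrow> real. (\<forall>i. x (Suc i) \<le> x i) \<and> (\<forall>i. 0 \<le> x i) \<and> (\<Sum>i<n. x i) \<le> c}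
    \<subseteq> PiE UNIV (\<lambda>_. {0..c})"
proof
  fix x :: "nat \<Rightarrow> real"
  assume "x \<in> {x. (\<forall>i. x (Suc i) \<le> x i) \<and> (\<forall>i. 0 \<le> x i) \<and> (\<Sum>i<n. x i) \<le> c}"
  then have x: "\<And>i. x (Suc i) \<le> x i" "\<And>i. 0 \<le> x i" "(\<Sum>i<n. x i) \<le> c"
    by auto
  have "x 0 \<le> (\<Sum>i<n. x i)"
    using assms x(2) by (intro member_le_sum) auto
  moreover have "x i \<le> x 0" for i
    using x(1) by (induction i) (auto intro: order_trans)
  ultimately have "0 \<le> x i \<and> x i \<le> c" for i
    using x(2,3) by (meson order_trans)
  then show "x \<in> PiE UNIV (\<lambda>_. {0..c})"
    by auto
qed

lemma compact_Icc_sequences: "compact (PiE UNIV (\<lambda>_. {0..c}) :: (nat \<Rightarrow> real) set)"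
proof -
  have "compactin (product_topology (\<lambda>_::nat. euclidean :: real topology) UNIV) (PiE UNIV (\<lambda>_. {0..c}))"
    by (auto simp: compactin_PiE)
  then show ?thesis
    by (simp add: euclidean_product_topology)
qed

lemma ordered_sum_rate_sublevel:
  assumes "0 \<le> c"
  shows "{x. ordered_sum_rate x \<le> ennreal c} =
    (\<Inter>n. {x. (\<forall>i. x (Suc i) \<le> x i) \<and> (\<forall>i. 0 \<le> x i) \<and> (\<Sum>i<n. x i) \<le> c})"
  using assms by (auto simp: ordered_sum_rate_le_iff)

lemma closed_ordered_sum_rate_sublevel:
  assumes "0 \<le> c"
  shows "closed {x. ordered_sum_rate x \<le> ennreal c}"
  unfolding ordered_sum_rate_sublevel[OF assms] by (intro closed_INT ballI closed_ordered_partial_sum)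

lemma good_rate_function_ordered_sum_rate: "good_rate_function nonneg_sequences ordered_sum_rate"
proof -
  have sub: "{x \<in> topspace nonneg_sequences. ordered_sum_rate x \<le> ennreal c} =
      {x. ordered_sum_rate x \<le> ennreal c}" if "0 \<le> c" for c
    using that by (auto simp: topspace_nonneg_sequences ordered_sum_rate_le_iff)
  have "closedin nonneg_sequences {x \<in> topspace nonneg_sequences. ordered_sum_rate x \<le> c}" for c
  proof (cases c)
    case (real r)
    then show ?thesis
      using sub[of r] closed_ordered_sum_rate_sublevel[of r]
      by (auto simp: closedin_nonneg_sequences_iff ordered_sum_rate_le_iff)
  qed simp
  moreover have "compactin nonneg_sequences {x \<in> topspace nonneg_sequences. ordered_sum_rate x \<le> ennreal c}"
    if c: "0 \<le> c" for c
  proof -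
    have "{x. ordered_sum_rate x \<le> ennreal c} \<subseteq> PiE UNIV (\<lambda>_. {0..c})"
      unfolding ordered_sum_rate_sublevel[OF c]
      \<comment> \<open>The condition for \<open>n = 1\<close> already bounds the first coordinate
        by \<open>c\<close>.\<close>
      by (rule order_trans[OF INT_lower[of 1] ordered_partial_sum_subset]) auto
    then have "PiE UNIV (\<lambda>_. {0..c}) \<inter> {x. ordered_sum_rate x \<le> ennreal c} =
        {x. ordered_sum_rate x \<le> ennreal c}"
      by blast
    then have "compact {x. ordered_sum_rate x \<le> ennreal c}"
      using compact_Int_closed[OF compact_Icc_sequences closed_ordered_sum_rate_sublevel[OF c], of c]
      by metis
    moreover have "{x. ordered_sum_rate x \<le> ennreal c} \<subseteq> {x. \<forall>i. 0 \<le> x i}"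
      using ordered_sum_rate_le_iff[OF c] by blast
    ultimately show ?thesis
      unfolding sub[OF c] by (simp only: nonneg_sequences_eq compactin_subtopology compactin_euclidean_iff)
  qed
  ultimately show ?thesis
    by (simp add: good_rate_function_def rate_function_def)
qed

text \<open>If every \<open>n\<close> failed, the ordered sequences in \<open>F\<close> with small
  partial sums would form a decreasing family of nonempty closed subsets of a compact box. A common
  point would lie in \<open>F\<close> with rate at most \<open>r\<close>.\<close>

lemma closed_partial_sum_gt:
  assumes "closedin nonneg_sequences F" and "0 \<le> r"
    and "\<And>x. x \<in> F \<Longrightarrow> ennreal r < ordered_sum_rate x"
  obtains n where "\<And>x. \<lbrakk>x \<in> F; \<And>i. x (Suc i) \<le> x i\<rbrakk> \<Longrightarrow> r < (\<Sum>i<n. x i)"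
proof -
  have "\<exists>n. \<forall>x\<in>F. (\<forall>i. x (Suc i) \<le> x i) \<longrightarrow> r < (\<Sum>i<n. x i)"
  proof (rule ccontr)
    assume neg: "\<not> ?thesis"
    \<comment> \<open>With \<open>Suc n\<close> the partial sum always contains the first
      coordinate, so that even \<open>S 0\<close> lies in the box.\<close>
    define S where "S n = F \<inter> {x. (\<forall>i. x (Suc i) \<le> x i) \<and> (\<forall>i. 0 \<le> x i) \<and> (\<Sum>i<Suc n. x i) \<le> r}" for n
    have F: "closed F" "\<And>x i. x \<in> F \<Longrightarrow> 0 \<le> x i"
      using assms(1) by (auto simp: closedin_nonneg_sequences_iff)
    have ne: "S n \<noteq> {}" for n
    proof -
      obtain x where "x \<in> F" "\<And>i. x (Suc i) \<le> x i" "\<not> r < (\<Sum>i<Suc n. x i)"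
        using neg by blast
      then show ?thesis
        using F(2) by (auto simp: S_def not_less)
    qed
    have anti: "S n \<subseteq> S m" if "m \<le> n" for m n
    proof -
      have "(\<Sum>i<Suc m. x i) \<le> (\<Sum>i<Suc n. x i)" if "\<And>i. 0 \<le> x i" for x :: "nat \<Rightarrow> real"
        using \<open>m \<le> n\<close> that by (intro sum_mono2) auto
      then show ?thesis
        unfolding S_def by (blast intro: order_trans)
    qed
    have sub: "S n \<subseteq> PiE UNIV (\<lambda>_. {0..r})" for n
      using ordered_partial_sum_subset[of "Suc n" r] unfolding S_def by blast
    have "PiE UNIV (\<lambda>_. {0..r}) \<inter> (\<Inter>n\<in>UNIV. S n) \<noteq> {}"
    proof (rule compact_imp_fip_image[OF compact_Icc_sequences])
      show "closed (S n)" for n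
        unfolding S_def by (intro closed_Int F(1) closed_ordered_partial_sum)
      fix I :: "nat set"
      assume "finite I"
      then obtain m where "\<And>i. i \<in> I \<Longrightarrow> i \<le> m"
        using finite_nat_set_iff_bounded_le by auto
      then have "S m \<subseteq> PiE UNIV (\<lambda>_. {0..r}) \<inter> (\<Inter>i\<in>I. S i)"
        using anti by (intro Int_greatest sub INT_greatest) auto
      then show "PiE UNIV (\<lambda>_. {0..r}) \<inter> (\<Inter>i\<in>I. S i) \<noteq> {}"
        using ne[of m] by (metis subset_empty)
    qed
    then obtain x where "x \<in> PiE UNIV (\<lambda>_. {0..r}) \<inter> (\<Inter>n\<in>UNIV. S n)"
      by (meson ex_in_conv)
    then have x: "x \<in> S n" for n
      by (rule INT_D[OF IntD2]) simp
    have "(\<Sum>i<n. x i) \<le> r" for n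
    proof (cases n)
      case (Suc m)
      then show ?thesis
        using x[of m] by (simp only: S_def) blast
    qed (use assms(2) in simp)
    then have "ordered_sum_rate x \<le> ennreal r"
      using x unfolding ordered_sum_rate_le_iff[OF assms(2)] S_def by blast
    then show False
      using assms(3)[of x] x[of 0] by (simp only: S_def Int_iff not_le[symmetric])
  qed
  then show thesis
    using that by blast
qed

section \<open>Borel sets of the sequence space and measurability of random sequences\<close>

lemma space_borel_of_topology: "space (borel_of_topology X) = topspace X"
  unfolding borel_of_topology_def by (rule space_measure_of) (auto dest: openin_subset)

lemma sets_borel_of_topology: "sets (borel_of_topology X) = sigma_sets (topspace X) {U. openin X U}"
  unfolding borel_of_topology_def by (rule sets_measure_of) (auto dest: openin_subset)

lemma openin_in_sets_borel_of_topology: "openin X U \<Longrightarrow> U \<in> sets (borel_of_topology X)"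
  by (simp add: sets_borel_of_topology sigma_sets.Basic)

lemma closedin_in_sets_borel_of_topology:
  assumes "closedin X F"
  shows "F \<in> sets (borel_of_topology X)"
proof -
  have "topspace X - (topspace X - F) \<in> sigma_sets (topspace X) {U. openin X U}"
    using assms by (intro sigma_sets.Compl sigma_sets.Basic) auto
  then show ?thesis
    using closedin_subset[OF assms] by (simp add: sets_borel_of_topology double_diff)
qed

text \<open>A relatively open set is the trace of an open set \<open>T\<close> of the full sequence
  space and has the same preimage as \<open>T\<close>. On the full space, a countable product,
  coordinatewise measurability suffices.\<close>

lemma measurable_nonneg_sequences:
  assumes "\<And>i. (\<lambda>\<omega>. X \<omega> i) \<in> borel_measurable M" and "\<And>\<omega> i. \<omega> \<in> space M \<Longrightarrow> 0 \<le> X \<omega> i"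
  shows "X \<in> measurable M (borel_of_topology nonneg_sequences)"
  unfolding borel_of_topology_def
proof (rule measurable_measure_of)
  show "{U. openin nonneg_sequences U} \<subseteq> Pow (topspace nonneg_sequences)"
    using openin_subset by blast
  show "X \<in> space M \<rightarrow> topspace nonneg_sequences"
    using assms(2) by (simp add: topspace_nonneg_sequences)
  have X: "X \<in> borel_measurable M"
    using assms(1) by (rule measurable_coordinatewise_then_product)
  fix U
  assume "U \<in> {U. openin nonneg_sequences U}"
  then obtain T where T: "open T" "U = {x. \<forall>i. 0 \<le> x i} \<inter> T"
    by (auto simp: nonneg_sequences_eq openin_open)
  then have "X -` U \<inter> space M = X -` T \<inter> space M"
    using assms(2) by auto
  then show "X -` U \<inter> space M \<in> sets M"
    using X T(1) by (metis borel_open measurable_sets)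
qed

subsection \<open>Logarithmic limits\<close>

text \<open>A prefactor \<open>C\<close> contributes only \<open>ln C / \<theta>\<close>, which
  vanishes in the limit. For \<open>p = 0\<close> the left side is
  \<open>-\<infinity>\<close>.\<close>

lemma log_prob_upper:
  assumes "0 < \<theta>" "0 < C" "0 \<le> p" "p \<le> C * exp (- \<theta> * r)"
  shows "ereal (1 / \<theta>) * log_prob p \<le> ereal (ln C / \<theta> - r)"
proof (cases "p = 0")
  case False
  then have "ln p \<le> ln (C * exp (- \<theta> * r))"
    using assms by (intro ln_mono) auto
  also have "\<dots> = ln C - \<theta> * r"
    using assms by (simp add: ln_mult)
  finally have "ln p / \<theta> \<le> (ln C - \<theta> * r) / \<theta>"
    using assms by (intro divide_right_mono) auto
  then show ?thesis
    using assms False by (simp add: log_prob_def diff_divide_distrib)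
qed (use assms in \<open>simp add: log_prob_def\<close>)

lemma log_prob_lower:
  assumes "0 < \<theta>" "0 < C" "C * exp (- \<theta> * r) \<le> p"
  shows "ereal (ln C / \<theta> - r) \<le> ereal (1 / \<theta>) * log_prob p"
proof -
  have "0 < C * exp (- \<theta> * r)"
    using assms by simp
  then have "0 < p"
    using assms(3) by linarith
  have "ln C - \<theta> * r = ln (C * exp (- \<theta> * r))"
    using assms by (simp add: ln_mult)
  also have "\<dots> \<le> ln p"
    using \<open>0 < C * exp _\<close> assms(3) by (intro ln_mono) auto
  finally have "(ln C - \<theta> * r) / \<theta> \<le> ln p / \<theta>"
    using assms by (intro divide_right_mono) auto
  then show ?thesis
    using assms \<open>0 < p\<close> by (simp add: log_prob_def diff_divide_distrib)
qed

lemma tendsto_log_const_over: "((\<lambda>\<theta>. ereal (c / \<theta> - r)) \<longlongrightarrow> ereal (- r)) at_top"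
proof -
  have "((\<lambda>\<theta>. c / \<theta> - r) \<longlongrightarrow> 0 - r) at_top"
    by (intro tendsto_diff tendsto_const tendsto_divide_0[OF tendsto_const] filterlim_at_top_imp_at_infinity filterlim_ident)
  then show ?thesis
    by (simp add: tendsto_ereal)
qed

lemma Limsup_log_prob_le:
  assumes "0 < C" and "eventually (\<lambda>\<theta>. 0 \<le> p \<theta> \<and> p \<theta> \<le> C * exp (- \<theta> * r)) at_top"
  shows "Limsup at_top (\<lambda>\<theta>. ereal (1 / \<theta>) * log_prob (p \<theta>)) \<le> ereal (- r)"
proof -
  have "eventually (\<lambda>\<theta>. ereal (1 / \<theta>) * log_prob (p \<theta>) \<le> ereal (ln C / \<theta> - r)) at_top"
    using assms(2) eventually_gt_at_top[of 0]
    by eventually_elim (use assms(1) log_prob_upper in blast)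
  then have "Limsup at_top (\<lambda>\<theta>. ereal (1 / \<theta>) * log_prob (p \<theta>)) \<le> Limsup at_top (\<lambda>\<theta>. ereal (ln C / \<theta> - r))"
    by (rule Limsup_mono)
  also have "\<dots> = ereal (- r)"
    by (rule lim_imp_Limsup[OF _ tendsto_log_const_over]) simp
  finally show ?thesis .
qed

lemma Liminf_log_prob_ge:
  assumes "0 < C" and "eventually (\<lambda>\<theta>. C * exp (- \<theta> * r) \<le> p \<theta>) at_top"
  shows "ereal (- r) \<le> Liminf at_top (\<lambda>\<theta>. ereal (1 / \<theta>) * log_prob (p \<theta>))"
proof -
  have "eventually (\<lambda>\<theta>. ereal (ln C / \<theta> - r) \<le> ereal (1 / \<theta>) * log_prob (p \<theta>)) at_top"
    using assms(2) eventually_gt_at_top[of 0]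
    by eventually_elim (use assms(1) log_prob_lower in blast)
  then have "Liminf at_top (\<lambda>\<theta>. ereal (ln C / \<theta> - r)) \<le> Liminf at_top (\<lambda>\<theta>. ereal (1 / \<theta>) * log_prob (p \<theta>))"
    by (rule Liminf_mono)
  moreover have "Liminf at_top (\<lambda>\<theta>. ereal (ln C / \<theta> - r)) = ereal (- r)"
    by (rule lim_imp_Liminf[OF _ tendsto_log_const_over]) simp
  ultimately show ?thesis
    by simp
qed

subsection \<open>Poisson counts\<close>

text \<open>The left side is the probability that a Poisson variable of mean \<open>x\<close> is at
  least \<open>m\<close>. In the Lagrange remainder \<open>exp t / fact m * x ^ m\<close> the factor
  \<open>exp t \<le> exp x\<close> is cancelled by \<open>exp (- x)\<close>.\<close>

lemma exp_Taylor_remainder_le: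
  fixes x :: real
  assumes "0 \<le> x"
  shows "1 - exp (- x) * (\<Sum>k<m. x ^ k / fact k) \<le> x ^ m"
proof -
  obtain t where t: "\<bar>t\<bar> \<le> \<bar>x\<bar>" "exp x = (\<Sum>k<m. x ^ k / fact k) + exp t / fact m * x ^ m"
    using Maclaurin_exp_le by blast
  have "exp t / fact m * x ^ m \<le> exp x * x ^ m"
  proof (rule mult_right_mono)
    have "exp t / fact m \<le> exp t / 1"
      by (intro divide_left_mono) (auto simp: fact_ge_1)
    also have "\<dots> \<le> exp x"
      using t(1) assms by simp
    finally show "exp t / fact m \<le> exp x" .
  qed (use assms in simp)
  then have "exp (- x) * (exp x - (\<Sum>k<m. x ^ k / fact k)) \<le> exp (- x) * (exp x * x ^ m)"
    using t(2) by (intro mult_left_mono) auto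
  also have "\<dots> = x ^ m"
    by (simp add: exp_minus)
  finally show ?thesis
    by (simp add: right_diff_distrib exp_minus)
qed

text \<open>The process prescribes probabilities of exact counts; this writes "at least
  \<open>m\<close> points" as the complement of finitely many such events.\<close>

lemma ennreal_ge_of_nat_iff:
  assumes "x \<in> insert \<infinity> (range of_nat)"
  shows "of_nat m \<le> (x::ennreal) \<longleftrightarrow> (\<forall>k<m. x \<noteq> of_nat k)"
  using assms by (auto simp: not_less[symmetric])

lemma point_count_cases: "point_count \<Xi> A \<omega> \<in> insert \<infinity> (range of_nat)"
  by (cases "finite (\<Xi> \<omega> \<inter> A)") (auto simp: point_count_def emeasure_count_space)

lemma poisson_point_process_measurable:
  assumes "poisson_point_process W \<mu> \<Xi>" and "A \<in> sets \<mu>" and "B \<in> sets borel"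
  shows "{\<omega> \<in> space W. point_count \<Xi> A \<omega> \<in> B} \<in> sets W"
proof -
  have "point_count \<Xi> A \<in> borel_measurable W"
    using assms by (auto simp: poisson_point_process_def)
  from measurable_sets[OF this assms(3)] show ?thesis
    by (simp add: vimage_def Collect_conj_eq Int_commute)
qed

lemma poisson_point_process_prob_count:
  assumes "poisson_point_process W \<mu> \<Xi>" and "A \<in> sets \<mu>" and "emeasure \<mu> A < \<infinity>"
  shows "measure W {\<omega> \<in> space W. point_count \<Xi> A \<omega> = of_nat k} =
    exp (- measure \<mu> A) * measure \<mu> A ^ k / fact k"
  using assms unfolding poisson_point_process_def by blast

lemma poisson_point_process_count_ge_le:
  assumes ppp: "poisson_point_process W \<mu> \<Xi>" and A: "A \<in> sets \<mu>" and fin: "emeasure \<mu> A < \<infinity>"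
  shows "measure W {\<omega> \<in> space W. of_nat m \<le> point_count \<Xi> A \<omega>} \<le> measure \<mu> A ^ m"
proof -
  interpret prob_space W
    using ppp by (simp add: poisson_point_process_def)
  define E where "E k = {\<omega> \<in> space W. point_count \<Xi> A \<omega> = of_nat k}" for k
  have E[measurable]: "E k \<in> sets W" for k
    using poisson_point_process_measurable[OF ppp A, of "{of_nat k}"] by (simp add: E_def)
  have pE: "prob (E k) = exp (- measure \<mu> A) * measure \<mu> A ^ k / fact k" for k
    unfolding E_def by (rule poisson_point_process_prob_count[OF ppp A fin])
  have "{\<omega> \<in> space W. of_nat m \<le> point_count \<Xi> A \<omega>} = space W - (\<Union>k\<in>{..<m}. E k)"
    by (auto simp: E_def ennreal_ge_of_nat_iff[OF point_count_cases])
  then have "prob {\<omega> \<in> space W. of_nat m \<le> point_count \<Xi> A \<omega>} = 1 - prob (\<Union>k\<in>{..<m}. E k)"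
    by (simp add: prob_compl)
  also have "prob (\<Union>k\<in>{..<m}. E k) = (\<Sum>k<m. prob (E k))"
    by (rule finite_measure_finite_Union) (use E in \<open>auto simp: disjoint_family_on_def E_def\<close>)
  also have "\<dots> = exp (- measure \<mu> A) * (\<Sum>k<m. measure \<mu> A ^ k / fact k)"
    by (simp add: pE sum_distrib_left)
  finally show ?thesis
    using exp_Taylor_remainder_le[of "measure \<mu> A" m] by simp
qed

text \<open>The range \<open>Suc n\<close> makes the family of events nonempty, as the product
  formula for an intersection over the index set requires. Both uses have one cell more than a given
  number.\<close>

lemma poisson_point_process_indep:
  assumes ppp: "poisson_point_process W \<mu> \<Xi>" and A: "\<And>i. i < Suc n \<Longrightarrow> A i \<in> sets \<mu>"
    and disj: "disjoint_family_on A {..<Suc n}" and B: "\<And>i. i < Suc n \<Longrightarrow> B i \<in> sets borel"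
  shows "measure W {\<omega> \<in> space W. \<forall>i<Suc n. point_count \<Xi> (A i) \<omega> \<in> B i} =
    (\<Prod>i<Suc n. measure W {\<omega> \<in> space W. point_count \<Xi> (A i) \<omega> \<in> B i})"
proof -
  interpret prob_space W
    using ppp by (simp add: poisson_point_process_def)
  have "indep_vars (\<lambda>_. borel) (\<lambda>i. point_count \<Xi> (A i)) {..<Suc n}"
    using ppp A disj unfolding poisson_point_process_def by blast
  then have "prob (\<Inter>i\<in>{..<Suc n}. point_count \<Xi> (A i) -` B i \<inter> space W) =
      (\<Prod>i<Suc n. prob (point_count \<Xi> (A i) -` B i \<inter> space W))"
    by (rule indep_varsD) (use B in auto)
  moreover have "(\<Inter>i\<in>{..<Suc n}. point_count \<Xi> (A i) -` B i \<inter> space W) =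
      {\<omega> \<in> space W. \<forall>i<Suc n. point_count \<Xi> (A i) \<omega> \<in> B i}"
    by auto
  moreover have "point_count \<Xi> (A i) -` B i \<inter> space W = {\<omega> \<in> space W. point_count \<Xi> (A i) \<omega> \<in> B i}" for i
    by auto
  ultimately show ?thesis
    by simp
qed

subsection \<open>The mean measure\<close>

lemma space_gamma_mean_measure: "space (gamma_mean_measure \<theta>) = {0<..}"
  by (simp add: gamma_mean_measure_def space_restrict_space)

lemma sets_gamma_mean_measure_iff: "A \<in> sets (gamma_mean_measure \<theta>) \<longleftrightarrow> A \<in> sets borel \<and> A \<subseteq> {0<..}"
  by (auto simp: gamma_mean_measure_def sets_restrict_space_iff)

lemma emeasure_gamma_mean_measure:
  assumes "A \<in> sets borel" "A \<subseteq> {0<..}"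
  shows "emeasure (gamma_mean_measure \<theta>) A =
    (\<integral>\<^sup>+x. ennreal (\<theta> * inverse x * exp (- x)) * indicator A x \<partial>lborel)"
proof -
  have "emeasure (gamma_mean_measure \<theta>) A =
      (\<integral>\<^sup>+x. ennreal (\<theta> * inverse x * exp (- x)) * indicator A x \<partial>restrict_space lborel {0<..})"
    unfolding gamma_mean_measure_def using assms
    by (intro emeasure_density) (auto simp: sets_restrict_space_iff intro!: measurable_restrict_space1)
  also have "\<dots> = (\<integral>\<^sup>+x. ennreal (\<theta> * inverse x * exp (- x)) * indicator A x * indicator {0<..} x \<partial>lborel)"
    by (rule nn_integral_restrict_space) simp
  also have "\<dots> = (\<integral>\<^sup>+x. ennreal (\<theta> * inverse x * exp (- x)) * indicator A x \<partial>lborel)"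
    using assms by (intro nn_integral_cong) (auto simp: indicator_def)
  finally show ?thesis .
qed

text \<open>For \<open>x \<ge> \<theta> * t\<close> the factor \<open>\<theta> / x\<close> is at
  most \<open>1 / t\<close>, which removes \<theta> from the prefactor; the remaining tail of
  \<open>exp (- x)\<close> integrates exactly.\<close>

lemma emeasure_gamma_mean_measure_le:
  assumes "0 < \<theta>" "0 < t" "A \<in> sets borel" "A \<subseteq> {\<theta> * t..}"
  shows "emeasure (gamma_mean_measure \<theta>) A \<le> ennreal (exp (- \<theta> * t) / t)"
proof -
  have "0 < \<theta> * t"
    using assms by simp
  then have "A \<subseteq> {0<..}"
    using assms(4) by force
  have F: "((\<lambda>x. - exp (- x) / t) \<longlongrightarrow> - 0 / t) at_top"
    by (intro tendsto_intros filterlim_compose[OF exp_at_bot] filterlim_uminus_at_bot_at_top) (use assms in auto)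
  have "emeasure (gamma_mean_measure \<theta>) A =
      (\<integral>\<^sup>+x. ennreal (\<theta> * inverse x * exp (- x)) * indicator A x \<partial>lborel)"
    by (rule emeasure_gamma_mean_measure) fact+
  also have "\<dots> \<le> (\<integral>\<^sup>+x. ennreal (exp (- x) / t) * indicator {\<theta> * t..} x \<partial>lborel)"
  proof (intro nn_integral_mono)
    fix x :: real
    have "\<theta> * inverse x * exp (- x) \<le> exp (- x) / t" if "\<theta> * t \<le> x"
    proof -
      have "\<theta> / x \<le> 1 / t"
        using that assms \<open>0 < \<theta> * t\<close> frac_le[of \<theta> \<theta> "\<theta> * t" x] by simp
      from mult_right_mono[OF this, of "exp (- x)"] show ?thesis
        by (simp add: field_simps)
    qed
    then show "ennreal (\<theta> * inverse x * exp (- x)) * indicator A x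
        \<le> ennreal (exp (- x) / t) * indicator {\<theta> * t..} x"
      using assms(4) by (auto simp: indicator_def intro: ennreal_leI)
  qed
  also have "\<dots> = ennreal (- 0 / t - (- exp (- (\<theta> * t)) / t))"
    by (rule nn_integral_FTC_atLeast[OF _ _ _ F]) (use assms in \<open>auto intro!: derivative_eq_intros\<close>)
  finally show ?thesis
    by simp
qed

lemma measure_gamma_mean_measure_le:
  assumes "0 < \<theta>" "0 < t" "A \<in> sets borel" "A \<subseteq> {\<theta> * t..}"
  shows "measure (gamma_mean_measure \<theta>) A \<le> exp (- \<theta> * t) / t"
  using emeasure_gamma_mean_measure_le[OF assms] assms(2)
  unfolding measure_def by (intro enn2real_leI) auto

text \<open>On the interval the density is at least its value
  \<open>exp (- \<theta> * b) / b\<close> at the right endpoint, and the interval has length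
  \<open>\<theta> * (b - a)\<close>.\<close>

lemma measure_gamma_mean_measure_ge:
  assumes "0 < \<theta>" "0 < a" "a < b"
  shows "\<theta> * ((b - a) / b * exp (- \<theta> * b)) \<le> measure (gamma_mean_measure \<theta>) {\<theta> * a<..\<theta> * b}"
proof -
  let ?A = "{\<theta> * a<..\<theta> * b}" and ?c = "exp (- \<theta> * b) / b"
  have pos: "0 < \<theta> * a"
    using assms by simp
  have "ennreal (\<theta> * ((b - a) / b * exp (- \<theta> * b))) = ennreal ?c * emeasure lborel ?A"
    using assms by (simp add: ennreal_mult[symmetric] field_simps)
  also have "\<dots> = (\<integral>\<^sup>+x. ennreal ?c * indicator ?A x \<partial>lborel)"
    by (simp add: nn_integral_cmult_indicator)
  also have "\<dots> \<le> (\<integral>\<^sup>+x. ennreal (\<theta> * inverse x * exp (- x)) * indicator ?A x \<partial>lborel)"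
  proof (intro nn_integral_mono)
    fix x :: real
    have "?c \<le> \<theta> * inverse x * exp (- x)" if "x \<in> ?A"
    proof -
      have x: "0 < x" "x \<le> \<theta> * b"
        using that pos by auto
      then have "1 / b \<le> \<theta> / x"
        using assms by (simp add: field_simps)
      then have "exp (- \<theta> * b) * (1 / b) \<le> exp (- x) * (\<theta> / x)"
        using x assms by (intro mult_mono) auto
      then show ?thesis
        by (simp add: field_simps)
    qed
    then show "ennreal ?c * indicator ?A x \<le> ennreal (\<theta> * inverse x * exp (- x)) * indicator ?A x"
      by (auto simp: indicator_def intro: ennreal_leI)
  qed
  also have "\<dots> = emeasure (gamma_mean_measure \<theta>) ?A"
    using pos by (intro emeasure_gamma_mean_measure[symmetric]) auto
  finally have le: "ennreal (\<theta> * ((b - a) / b * exp (- \<theta> * b))) \<le> emeasure (gamma_mean_measure \<theta>) ?A" .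
  \<comment> \<open>Finiteness is needed to pass from \<open>emeasure\<close> to
    \<open>measure\<close>, because \<open>enn2real\<close> sends \<infinity> to 0.\<close>
  have "emeasure (gamma_mean_measure \<theta>) ?A \<le> ennreal (exp (- \<theta> * a) / a)"
    using assms by (intro emeasure_gamma_mean_measure_le) auto
  then have "emeasure (gamma_mean_measure \<theta>) ?A < \<infinity>"
    by (auto intro: le_less_trans)
  then have "enn2real (ennreal (\<theta> * ((b - a) / b * exp (- \<theta> * b)))) \<le> measure (gamma_mean_measure \<theta>) ?A"
    using le unfolding measure_def by (intro enn2real_mono) auto
  then show ?thesis
    using assms by simp
qed

subsection \<open>The largest points\<close>

text \<open>A union bound over at most \<open>Suc K ^ n\<close> occupations, each point paying a
  factor \<open>max 1 (1 / \<delta>)\<close>. Replacing points by the left ends of their cells costs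
  at most \<delta> per point, whence the loss \<open>n * \<delta>\<close> in the exponent.\<close>

lemma poisson_top_sum_upper_bound:
  fixes \<gamma> :: "nat \<Rightarrow> 'w \<Rightarrow> real"
  assumes ppp: "poisson_point_process W (gamma_mean_measure \<theta>) \<Xi>" and \<theta>: "0 < \<theta>"
    and enum: "AE \<omega> in W. (\<forall>n. \<gamma> (Suc n) \<omega> < \<gamma> n \<omega>) \<and> range (\<lambda>n. \<gamma> n \<omega>) = \<Xi> \<omega>"
    and \<delta>: "0 < \<delta>" and K: "r \<le> \<delta> * real K"
    and E: "E \<in> sets W" "AE \<omega> in W. \<omega> \<in> E \<longrightarrow> \<theta> * r < (\<Sum>i<n. \<gamma> i \<omega>)"
  shows "measure W E \<le> (real (Suc K) * max 1 (1 / \<delta>)) ^ n * exp (- \<theta> * (r - n * \<delta>))"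
proof -
  interpret prob_space W
    using ppp by (simp add: poisson_point_process_def)
  have \<Xi>_pos: "\<Xi> \<omega> \<subseteq> {0<..}" if "\<omega> \<in> space W" for \<omega>
    using ppp that by (simp add: poisson_point_process_def space_gamma_mean_measure)
  \<comment> \<open>The last cell \<open>K\<close> is unbounded, so the number of occupations does
    not depend on \<theta>. By the choice of \<open>K\<close>, a single point in it already accounts
    for the whole of \<open>r\<close>.\<close>
  define cell where "cell x = min K (nat \<lfloor>x / (\<theta> * \<delta>)\<rfloor>)" for x :: real
  define C where "C j = {0<..} \<inter> cell -` {j}" for j
  define m where "m k j = card {i \<in> {..<n}. k i = j}" for k :: "nat \<Rightarrow> nat" and j
  define good where "good = {k \<in> {..<n} \<rightarrow>\<^sub>E {..K}. r \<le> \<delta> * (real (\<Sum>i<n. k i) + n)}"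
  \<comment> \<open>Counts are bounded only from below, since points beyond the first
    \<open>n\<close> may fall into the same cells.\<close>
  define F where "F k = {\<omega> \<in> space W. \<forall>j<Suc K. point_count \<Xi> (C j) \<omega> \<in> {of_nat (m k j)..}}" for k
  define D where "D = max 1 (1 / \<delta>)"
  \<comment> \<open>Cell 0 reaches down to the origin and has infinite mean measure, so only the
    trivial bound 1 is available there; it costs nothing, as its left end is 0.\<close>
  define g where "g j = (if j = 0 then 1 else D * exp (- \<theta> * (j * \<delta>)))" for j :: nat
  have d: "0 < \<theta> * \<delta>"
    using \<theta> \<delta> by simp
  have D: "1 \<le> D" "1 / \<delta> \<le> D"
    by (simp_all add: D_def)
  have cell_measurable: "cell \<in> measurable borel (count_space UNIV)"
    unfolding cell_def by measurable
  have "cell -` {j} \<in> sets borel" for j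
    using measurable_sets[OF cell_measurable, of "{j}"] by simp
  then have C_borel: "C j \<in> sets borel" for j
    unfolding C_def by (intro sets.Int) auto
  then have C_sets: "C j \<in> sets (gamma_mean_measure \<theta>)" for j
    by (auto simp: sets_gamma_mean_measure_iff C_def)
  have C_ge: "C j \<subseteq> {\<theta> * (j * \<delta>)..}" for j
  proof
    fix x
    assume "x \<in> C j"
    then have "0 < x" "j \<le> nat \<lfloor>x / (\<theta> * \<delta>)\<rfloor>"
      by (auto simp: C_def cell_def)
    then have "real j \<le> x / (\<theta> * \<delta>)"
      using d by (simp add: le_nat_iff le_floor_iff)
    then show "x \<in> {\<theta> * (j * \<delta>)..}"
      using d by (simp add: pos_le_divide_eq ac_simps)
  qed
  have cell_upper: "x < \<theta> * (\<delta> * (cell x + 1))" if "cell x \<noteq> K" "0 < x" for x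
  proof -
    have "cell x = nat \<lfloor>x / (\<theta> * \<delta>)\<rfloor>"
      using that by (auto simp: cell_def)
    then have "real (cell x) = \<lfloor>x / (\<theta> * \<delta>)\<rfloor>"
      using that d by simp
    then have "x / (\<theta> * \<delta>) < cell x + 1"
      by linarith
    then show ?thesis
      using d by (simp add: pos_divide_less_eq ac_simps)
  qed
  have g_bound: "prob {\<omega> \<in> space W. point_count \<Xi> (C j) \<omega> \<in> {of_nat l..}} \<le> g j ^ l" for j l
  proof (cases "j = 0")
    case False
    then have t: "0 < real j * \<delta>"
      using \<delta> by simp
    have "emeasure (gamma_mean_measure \<theta>) (C j) < \<infinity>"
      by (rule le_less_trans[OF emeasure_gamma_mean_measure_le[OF \<theta> t C_borel C_ge]]) simp
    then have "prob {\<omega> \<in> space W. of_nat l \<le> point_count \<Xi> (C j) \<omega>} \<le> measure (gamma_mean_measure \<theta>) (C j) ^ l"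
      by (rule poisson_point_process_count_ge_le[OF ppp C_sets])
    also have "\<dots> \<le> (exp (- \<theta> * (j * \<delta>)) / (j * \<delta>)) ^ l"
      by (intro power_mono measure_gamma_mean_measure_le[OF \<theta> t C_borel C_ge]) simp
    also have "\<dots> \<le> g j ^ l"
    proof (rule power_mono)
      have "1 / (j * \<delta>) \<le> 1 / \<delta>"
        using False \<delta> by (intro divide_left_mono) auto
      then have "1 / (j * \<delta>) \<le> D"
        using D by linarith
      from mult_right_mono[OF this, of "exp (- \<theta> * (j * \<delta>))"]
      show "exp (- \<theta> * (j * \<delta>)) / (j * \<delta>) \<le> g j"
        using False by (simp add: g_def)
    qed (use \<delta> in simp)
    finally show ?thesis
      by simp
  qed (simp add: g_def)
  have F_sets: "F k \<in> sets W" for k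
  proof -
    have "F k = space W \<inter> (\<Inter>j\<in>{..<Suc K}. {\<omega> \<in> space W. point_count \<Xi> (C j) \<omega> \<in> {of_nat (m k j)..}})"
      by (auto simp: F_def)
    also have "\<dots> \<in> sets W"
      by (intro sets.Int sets.finite_INT poisson_point_process_measurable[OF ppp C_sets]) auto
    finally show ?thesis .
  qed
  have F_bound: "prob (F k) \<le> D ^ n * exp (- \<theta> * (r - n * \<delta>))" if k: "k \<in> good" for k
  proof -
    have "prob (F k) = (\<Prod>j<Suc K. prob {\<omega> \<in> space W. point_count \<Xi> (C j) \<omega> \<in> {of_nat (m k j)..}})"
      unfolding F_def by (rule poisson_point_process_indep[OF ppp C_sets])
        (auto simp: disjoint_family_on_def C_def)
    also have "\<dots> \<le> (\<Prod>j<Suc K. g j ^ m k j)"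
      by (intro prod_mono conjI measure_nonneg g_bound)
    also have "\<dots> = (\<Prod>j<Suc K. \<Prod>i\<in>{i \<in> {..<n}. k i = j}. g (k i))"
      by (intro prod.cong) (auto simp: m_def)
    \<comment> \<open>The product over cells is regrouped into one over points; empty cells
      contribute 1.\<close>
    also have "\<dots> = (\<Prod>i<n. g (k i))"
    proof (rule prod.group)
      show "k ` {..<n} \<subseteq> {..<Suc K}"
        using k unfolding good_def lessThan_Suc_atMost by blast
    qed simp_all
    also have "\<dots> \<le> (\<Prod>i<n. D * exp (- \<theta> * (k i * \<delta>)))"
      using D by (intro prod_mono) (auto simp: g_def)
    also have "\<dots> = D ^ n * exp (- \<theta> * (\<delta> * real (\<Sum>i<n. k i)))"
    proof -
      have "(\<Sum>i<n. - \<theta> * (k i * \<delta>)) = - \<theta> * (\<delta> * real (\<Sum>i<n. k i))"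
        by (simp add: sum_distrib_left sum_negf mult.commute)
      then show ?thesis
        by (simp add: prod.distrib exp_sum[symmetric])
    qed
    also have "\<dots> \<le> D ^ n * exp (- \<theta> * (r - n * \<delta>))"
    proof -
      have "r - n * \<delta> \<le> \<delta> * real (\<Sum>i<n. k i)"
        using k by (simp add: good_def algebra_simps)
      from mult_left_mono[OF this, of \<theta>] show ?thesis
        using \<theta> D by (intro mult_left_mono) auto
    qed
    finally show ?thesis .
  qed
  have "AE \<omega> in W. \<omega> \<in> E \<longrightarrow> \<omega> \<in> (\<Union>k\<in>good. F k)"
    using enum E(2) AE_space
  proof eventually_elim
    case (elim \<omega>)
    show ?case
    proof
      assume "\<omega> \<in> E"
      then have sum: "\<theta> * r < (\<Sum>i<n. \<gamma> i \<omega>)"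
        using elim by simp
      \<comment> \<open>Distinct indices must give distinct points for \<open>m k j\<close> to bound
        the count of the random set. The sign change turns the decreasing enumeration into an
        increasing one.\<close>
      have inj: "inj (\<lambda>i. \<gamma> i \<omega>)"
        using elim strict_mono_Suc_iff[of "\<lambda>i. - \<gamma> i \<omega>"] strict_mono_imp_inj_on[of "\<lambda>i. - \<gamma> i \<omega>"]
        by (auto simp: inj_on_def)
      have in_\<Xi>: "\<gamma> i \<omega> \<in> \<Xi> \<omega>" for i
        using elim by blast
      then have pos: "0 < \<gamma> i \<omega>" for i
        using \<Xi>_pos elim(3) by (meson greaterThan_iff subsetD)
      define k where "k = restrict (\<lambda>i. cell (\<gamma> i \<omega>)) {..<n}"
      have "r \<le> \<delta> * (real (\<Sum>i<n. k i) + n)"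
      proof (cases "\<exists>i<n. k i = K")
        case True
        then have "K \<le> (\<Sum>i<n. k i)"
          by (metis finite_lessThan lessThan_iff member_le_sum zero_le)
        then have "\<delta> * real K \<le> \<delta> * (real (\<Sum>i<n. k i) + n)"
          using \<delta> by (intro mult_left_mono) linarith+
        then show ?thesis
          using K by linarith
      next
        case False
        \<comment> \<open>No point lies in the unbounded cell, so each is bounded by the right end
          of its own cell.\<close>
        then have "(\<Sum>i<n. \<gamma> i \<omega>) \<le> (\<Sum>i<n. \<theta> * (\<delta> * (k i + 1)))"
          using pos cell_upper by (intro sum_mono) (auto simp: k_def less_imp_le)
        also have "\<dots> = \<theta> * (\<delta> * (real (\<Sum>i<n. k i) + n))"
          by (simp add: sum_distrib_left[symmetric] sum.distrib)
        finally have "\<theta> * r \<le> \<theta> * (\<delta> * (real (\<Sum>i<n. k i) + n))"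
          using sum by linarith
        then show ?thesis
          using \<theta> by (simp only: mult_le_cancel_left_pos)
      qed
      then have "k \<in> good"
        by (auto simp: good_def k_def cell_def)
      moreover have "of_nat (m k j) \<le> point_count \<Xi> (C j) \<omega>" for j
      proof -
        let ?S = "(\<lambda>i. \<gamma> i \<omega>) ` {i \<in> {..<n}. k i = j}"
        have "card ?S = m k j"
          unfolding m_def by (rule card_image) (use inj in \<open>auto simp: inj_on_def\<close>)
        then have "of_nat (m k j) = emeasure (count_space UNIV) ?S"
          by (simp add: emeasure_count_space)
        also have "\<dots> \<le> point_count \<Xi> (C j) \<omega>"
          unfolding point_count_def
          by (rule emeasure_mono) (use in_\<Xi> pos in \<open>auto simp: C_def k_def\<close>)
        finally show ?thesis .
      qed
      ultimately show "\<omega> \<in> (\<Union>k\<in>good. F k)"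
        using elim(3) by (auto simp: F_def)
    qed
  qed
  moreover have fin: "finite good"
    unfolding good_def by (rule finite_subset[of _ "{..<n} \<rightarrow>\<^sub>E {..K}"]) (auto intro: finite_PiE)
  ultimately have "prob E \<le> prob (\<Union>k\<in>good. F k)"
    using F_sets by (intro finite_measure_mono_AE sets.finite_UN) auto
  also have "\<dots> \<le> (\<Sum>k\<in>good. prob (F k))"
    using fin F_sets by (intro finite_measure_subadditive_finite) auto
  also have "\<dots> \<le> real (card good) * (D ^ n * exp (- \<theta> * (r - n * \<delta>)))"
    using F_bound by (rule sum_bounded_above)
  also have "\<dots> \<le> real (Suc K) ^ n * (D ^ n * exp (- \<theta> * (r - n * \<delta>)))"
  proof (rule mult_right_mono)
    have "card good \<le> card ({..<n} \<rightarrow>\<^sub>E {..K})"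
      by (intro card_mono finite_PiE) (auto simp: good_def)
    then have "card good \<le> Suc K ^ n"
      by (simp add: card_PiE)
    then show "real (card good) \<le> real (Suc K) ^ n"
      by (metis of_nat_le_iff of_nat_power)
  qed (use D in simp)
  finally show ?thesis
    by (simp add: D_def power_mult_distrib)
qed

text \<open>By strong induction, earlier points occupy the higher cells, so the point of cell
  \<open>i\<close> has index at least \<open>i\<close> and \<open>g i\<close> is not below that
  cell. Hence \<open>g i\<close> lies in some cell \<open>k\<close>: \<open>k > i\<close> would put
  it too low, and \<open>k < i\<close> would give cell \<open>k\<close> a second point besides
  \<open>g k\<close>.\<close>

lemma decreasing_enumeration_in_cells:
  fixes g :: "nat \<Rightarrow> 'a::linorder"
  assumes dec: "\<And>i j. i < j \<Longrightarrow> g j < g i"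
    and ab: "\<And>i. i < n \<Longrightarrow> c \<le> a i" "\<And>i j. i < j \<Longrightarrow> j < n \<Longrightarrow> b j \<le> a i"
    and one: "\<And>i. i < n \<Longrightarrow> \<exists>!p. p \<in> range g \<and> p \<in> {a i<..b i}"
    and none: "range g \<inter> ({c..} - (\<Union>i<n. {a i<..b i})) = {}"
    and "i < n"
  shows "g i \<in> {a i<..b i}"
  using \<open>i < n\<close>
proof (induction i rule: less_induct)
  case (less i)
  obtain l where l: "g l \<in> {a i<..b i}"
    using one[OF less.prems] by blast
  have "i \<le> l"
  proof (rule ccontr)
    assume "\<not> i \<le> l"
    then have "g l \<in> {a l<..b l}" "b i \<le> a l"
      using less ab(2) by auto
    then show False
      using l by force
  qed
  then have "g l \<le> g i"
    using dec[of i l] by (cases "i = l") auto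
  then have gi: "a i < g i"
    using l by auto
  then have "c \<le> g i"
    using ab(1)[OF less.prems] by auto
  then obtain k where k: "k < n" "g i \<in> {a k<..b k}"
    using none by blast
  have "k \<le> i"
  proof (rule ccontr)
    assume "\<not> k \<le> i"
    then have "b k \<le> a i"
      using ab(2)[of i k] k(1) by simp
    then show False
      using gi k(2) by auto
  qed
  moreover have "\<not> k < i"
  proof
    assume "k < i"
    then have "g k \<in> {a k<..b k}"
      using less.IH k(1) by blast
    then have "g k = g i"
      using one[OF k(1)] k(2) by blast
    then show False
      using dec[OF \<open>k < i\<close>] by simp
  qed
  ultimately show ?case
    using k(2) by simp
qed

text \<open>One point in each interval and none elsewhere above \<open>\<theta> * \<eta>\<close> are
  events on disjoint sets, so their probabilities multiply. All these sets have mean measure at most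
  \<open>1 / \<eta>\<close>, uniformly in \<theta>, which bounds every Poisson factor
  \<open>exp (- \<mu>)\<close> from below.\<close>

lemma poisson_top_points_lower_bound:
  fixes \<gamma> :: "nat \<Rightarrow> 'w \<Rightarrow> real"
  assumes ppp: "poisson_point_process W (gamma_mean_measure \<theta>) \<Xi>" and \<theta>: "1 \<le> \<theta>"
    and enum: "AE \<omega> in W. (\<forall>n. \<gamma> (Suc n) \<omega> < \<gamma> n \<omega>) \<and> range (\<lambda>n. \<gamma> n \<omega>) = \<Xi> \<omega>"
    and \<eta>: "0 < \<eta>" and ab: "\<And>i. i < n \<Longrightarrow> \<eta> \<le> a i" "\<And>i. i < n \<Longrightarrow> a i < b i"
      "\<And>i j. i < j \<Longrightarrow> j < n \<Longrightarrow> b j \<le> a i"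
    and E: "E \<in> sets W" "AE \<omega> in W. (\<forall>i<n. \<gamma> i \<omega> \<in> {\<theta> * a i<..\<theta> * b i}) \<longrightarrow> \<omega> \<in> E"
  shows "(\<Prod>i<n. exp (- (1 / \<eta>)) * ((b i - a i) / b i)) * exp (- (1 / \<eta>)) * exp (- \<theta> * (\<Sum>i<n. b i))
    \<le> measure W E"
proof -
  interpret prob_space W
    using ppp by (simp add: poisson_point_process_def)
  let ?\<mu> = "gamma_mean_measure \<theta>"
  have \<theta>0: "0 < \<theta>"
    using \<theta> by simp
  define J where "J i = {\<theta> * a i<..\<theta> * b i}" for i
  \<comment> \<open>Index \<open>n\<close> carries the remainder that must stay empty, so one
    application of independence covers all conditions.\<close>
  define A where "A i = (if i < n then J i else {\<theta> * \<eta>..} - (\<Union>j<n. J j))" for i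
  define B where "B i = (if i < n then {1} else {0 :: ennreal})" for i
  have J_ge: "J i \<subseteq> {\<theta> * \<eta>..}" if "i < n" for i
  proof -
    have "\<theta> * \<eta> \<le> \<theta> * a i"
      using ab(1)[OF that] \<theta>0 by simp
    then show ?thesis
      by (auto simp: J_def)
  qed
  have A_borel: "A i \<in> sets borel" for i
    by (auto simp: A_def J_def)
  have A_ge: "A i \<subseteq> {\<theta> * \<eta>..}" for i
    using J_ge by (auto simp: A_def)
  have "0 < \<theta> * \<eta>"
    using \<theta>0 \<eta> by simp
  then have A_sets: "A i \<in> sets ?\<mu>" for i
    using A_borel A_ge[of i] by (force simp: sets_gamma_mean_measure_iff)
  have A_fin: "emeasure ?\<mu> (A i) < \<infinity>" for i
    by (rule le_less_trans[OF emeasure_gamma_mean_measure_le[OF \<theta>0 \<eta> A_borel A_ge]]) simp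
  have A_le: "measure ?\<mu> (A i) \<le> 1 / \<eta>" for i
  proof -
    have "measure ?\<mu> (A i) \<le> exp (- \<theta> * \<eta>) / \<eta>"
      by (rule measure_gamma_mean_measure_le[OF \<theta>0 \<eta> A_borel A_ge])
    also have "\<dots> \<le> 1 / \<eta>"
      using \<theta>0 \<eta> by (intro divide_right_mono) auto
    finally show ?thesis .
  qed
  have J_disj: "J i \<inter> J j = {}" if "i < j" "j < n" for i j
  proof -
    have "\<theta> * b j \<le> \<theta> * a i"
      using ab(3)[OF that] \<theta>0 by simp
    then show ?thesis
      by (auto simp: J_def)
  qed
  have disj: "disjoint_family_on A {..<Suc n}"
    unfolding disjoint_family_on_def
  proof (intro ballI impI)
    fix i j
    assume "i \<in> {..<Suc n}" "j \<in> {..<Suc n}" "i \<noteq> j"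
    then show "A i \<inter> A j = {}"
      using J_disj[of i j] J_disj[of j i] by (cases i j rule: linorder_cases) (auto simp: A_def)
  qed
  have one_point: "exp (- (1 / \<eta>)) * ((b i - a i) / b i) * exp (- \<theta> * b i)
      \<le> prob {\<omega> \<in> space W. point_count \<Xi> (A i) \<omega> \<in> B i}" if i: "i < n" for i
  proof -
    have "0 < a i" "0 < b i"
      using ab(1,2)[OF i] \<eta> by linarith+
    then have nn: "0 \<le> (b i - a i) / b i * exp (- \<theta> * b i)"
      using ab(2)[OF i] by simp
    \<comment> \<open>Here \<theta> \<ge> 1 is used to drop the factor \<theta>, leaving a prefactor
      independent of it.\<close>
    have "(b i - a i) / b i * exp (- \<theta> * b i) \<le> \<theta> * ((b i - a i) / b i * exp (- \<theta> * b i))"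
      using mult_right_mono[OF \<theta> nn] by simp
    also have "\<dots> \<le> measure ?\<mu> (A i)"
      using measure_gamma_mean_measure_ge[OF \<theta>0 \<open>0 < a i\<close> ab(2)[OF i]] i by (simp add: A_def J_def)
    finally have "exp (- (1 / \<eta>)) * ((b i - a i) / b i * exp (- \<theta> * b i))
        \<le> exp (- measure ?\<mu> (A i)) * measure ?\<mu> (A i)"
      using A_le[of i] nn by (intro mult_mono) auto
    also have "\<dots> = prob {\<omega> \<in> space W. point_count \<Xi> (A i) \<omega> = of_nat 1}"
      using poisson_point_process_prob_count[OF ppp A_sets A_fin, of i 1] by simp
    finally show ?thesis
      using i by (simp add: B_def mult.assoc)
  qed
  have no_point: "exp (- (1 / \<eta>)) \<le> prob {\<omega> \<in> space W. point_count \<Xi> (A n) \<omega> \<in> B n}"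
  proof -
    have "exp (- (1 / \<eta>)) \<le> exp (- measure ?\<mu> (A n))"
      using A_le[of n] by simp
    also have "\<dots> = prob {\<omega> \<in> space W. point_count \<Xi> (A n) \<omega> = of_nat 0}"
      using poisson_point_process_prob_count[OF ppp A_sets A_fin, of n 0] by simp
    finally show ?thesis
      by (simp add: B_def)
  qed
  have "(\<Prod>i<n. exp (- (1 / \<eta>)) * ((b i - a i) / b i)) * exp (- (1 / \<eta>)) * exp (- \<theta> * (\<Sum>i<n. b i))
      = (\<Prod>i<n. exp (- (1 / \<eta>)) * ((b i - a i) / b i) * exp (- \<theta> * b i)) * exp (- (1 / \<eta>))"
    by (simp only: prod.distrib sum_distrib_left exp_sum[OF finite_lessThan] mult_ac)
  also have "\<dots> \<le> (\<Prod>i<n. prob {\<omega> \<in> space W. point_count \<Xi> (A i) \<omega> \<in> B i}) *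
      prob {\<omega> \<in> space W. point_count \<Xi> (A n) \<omega> \<in> B n}"
  proof (intro mult_mono prod_mono conjI one_point no_point prod_nonneg measure_nonneg ballI)
    fix i
    assume "i \<in> {..<n}"
    then show "0 \<le> exp (- (1 / \<eta>)) * ((b i - a i) / b i) * exp (- \<theta> * b i)"
      using ab(1,2)[of i] \<eta> by (simp add: zero_le_divide_iff)
  qed auto
  also have "\<dots> = prob {\<omega> \<in> space W. \<forall>i<Suc n. point_count \<Xi> (A i) \<omega> \<in> B i}"
    by (subst poisson_point_process_indep[OF ppp A_sets disj]) (auto simp: B_def)
  also have "\<dots> \<le> prob E"
  proof (rule finite_measure_mono_AE[OF _ E(1)])
    show "AE \<omega> in W. \<omega> \<in> {\<omega> \<in> space W. \<forall>i<Suc n. point_count \<Xi> (A i) \<omega> \<in> B i} \<longrightarrow> \<omega> \<in> E"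
      using enum E(2)
    proof eventually_elim
      case (elim \<omega>)
      show ?case
      proof
        assume \<omega>: "\<omega> \<in> {\<omega> \<in> space W. \<forall>i<Suc n. point_count \<Xi> (A i) \<omega> \<in> B i}"
        then have in_B: "point_count \<Xi> (A i) \<omega> \<in> B i" if "i < Suc n" for i
          using that by simp
        have dec: "\<gamma> j \<omega> < \<gamma> i \<omega>" if "i < j" for i j
          using elim(1) that strict_mono_Suc_iff[of "\<lambda>i. - \<gamma> i \<omega>"]
          by (auto simp: strict_mono_def)
        have one: "\<exists>!p. p \<in> range (\<lambda>i. \<gamma> i \<omega>) \<and> p \<in> {\<theta> * a i<..\<theta> * b i}" if "i < n" for i
        proof -
          have "emeasure (count_space UNIV) (\<Xi> \<omega> \<inter> J i) = 1"
            using in_B[of i] that by (simp add: A_def B_def point_count_def)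
          then have "card (\<Xi> \<omega> \<inter> J i) = 1"
            by (cases "finite (\<Xi> \<omega> \<inter> J i)") (auto simp: emeasure_count_space)
          then obtain p where "\<Xi> \<omega> \<inter> J i = {p}"
            by (auto simp: card_1_singleton_iff)
          then have "range (\<lambda>i. \<gamma> i \<omega>) \<inter> {\<theta> * a i<..\<theta> * b i} = {p}"
            using elim(1) by (simp only: J_def)
          then show ?thesis
            by (simp only: Int_iff[symmetric] singleton_iff ex1_eq)
        qed
        have none: "range (\<lambda>i. \<gamma> i \<omega>) \<inter> ({\<theta> * \<eta>..} - (\<Union>i<n. {\<theta> * a i<..\<theta> * b i})) = {}"
        proof -
          have "emeasure (count_space UNIV) (\<Xi> \<omega> \<inter> A n) = 0"
            using in_B[of n] by (simp add: B_def point_count_def)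
          then have "\<Xi> \<omega> \<inter> A n = {}"
            by (simp add: emeasure_count_space_eq_0)
          then show ?thesis
            using elim(1) by (simp add: A_def J_def)
        qed
        have "\<gamma> i \<omega> \<in> {\<theta> * a i<..\<theta> * b i}" if "i < n" for i
          by (rule decreasing_enumeration_in_cells[OF dec _ _ one none that])
            (use ab \<theta>0 in auto)
        then show "\<omega> \<in> E"
          using elim(2) by blast
      qed
    qed
  qed
  finally show ?thesis .
qed

subsection \<open>The large deviation principle\<close>

text \<open>Shares the hypotheses of the theorem among the following lemmas.\<close>

locale poisson_enumeration =
  fixes W :: "real \<Rightarrow> 'w measure"
    and \<Xi> :: "real \<Rightarrow> 'w \<Rightarrow> real set"
    and \<gamma> :: "real \<Rightarrow> nat \<Rightarrow> 'w \<Rightarrow> real"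
    and P :: "real \<Rightarrow> (nat \<Rightarrow> real) measure"
  assumes ppp: "\<And>\<theta>. \<theta> > 0 \<Longrightarrow> poisson_point_process (W \<theta>) (gamma_mean_measure \<theta>) (\<Xi> \<theta>)"
    and \<gamma>_measurable: "\<And>\<theta> n. \<theta> > 0 \<Longrightarrow> \<gamma> \<theta> n \<in> measurable (W \<theta>) (restrict_space borel {0<..})"
    and enum: "\<And>\<theta>. \<theta> > 0 \<Longrightarrow>
      AE \<omega> in W \<theta>. (\<forall>n. \<gamma> \<theta> (Suc n) \<omega> < \<gamma> \<theta> n \<omega>) \<and> range (\<lambda>n. \<gamma> \<theta> n \<omega>) = \<Xi> \<theta> \<omega>"
    and P_eq: "\<And>\<theta>. \<theta> > 0 \<Longrightarrow>
      P \<theta> = distr (W \<theta>) (borel_of_topology nonneg_sequences) (\<lambda>\<omega> n. \<gamma> \<theta> n \<omega> / \<theta>)"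
begin

lemma \<gamma>_pos: "\<theta> > 0 \<Longrightarrow> \<omega> \<in> space (W \<theta>) \<Longrightarrow> 0 < \<gamma> \<theta> n \<omega>"
  using measurable_space[OF \<gamma>_measurable] by (fastforce simp: space_restrict_space)

lemma scaled_measurable:
  assumes "\<theta> > 0"
  shows "(\<lambda>\<omega> n. \<gamma> \<theta> n \<omega> / \<theta>) \<in> measurable (W \<theta>) (borel_of_topology nonneg_sequences)"
proof (rule measurable_nonneg_sequences)
  show "(\<lambda>\<omega>. \<gamma> \<theta> i \<omega> / \<theta>) \<in> borel_measurable (W \<theta>)" for i
    using \<gamma>_measurable[OF assms, of i] by (auto simp: measurable_restrict_space2_iff)
  show "0 \<le> \<gamma> \<theta> i \<omega> / \<theta>" if "\<omega> \<in> space (W \<theta>)" for \<omega> i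
    using \<gamma>_pos[OF assms that, of i] assms by simp
qed

lemma prob_space_W: "\<theta> > 0 \<Longrightarrow> prob_space (W \<theta>)"
  using ppp by (simp add: poisson_point_process_def)

lemma prob_space_P: "\<theta> > 0 \<Longrightarrow> prob_space (P \<theta>)"
  using prob_space.prob_space_distr[OF prob_space_W scaled_measurable] by (simp add: P_eq)

lemma measure_P:
  assumes "\<theta> > 0" "S \<in> sets (borel_of_topology nonneg_sequences)"
  shows "measure (P \<theta>) S = measure (W \<theta>) ((\<lambda>\<omega> n. \<gamma> \<theta> n \<omega> / \<theta>) -` S \<inter> space (W \<theta>))"
  using assms by (simp add: P_eq measure_distr[OF scaled_measurable])

text \<open>The gap between \<open>s\<close> and \<open>r\<close> pays for the discretization loss
  \<open>n * \<delta>\<close>; \<open>n\<close> comes from compactness and is fixed before \<delta>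
  and \<open>K\<close>, all of them independent of \<theta>.\<close>

lemma Limsup_closed_le:
  assumes F: "closedin nonneg_sequences F" and s: "0 \<le> s" "s < r"
    and rate: "\<And>x. x \<in> F \<Longrightarrow> ennreal r < ordered_sum_rate x"
  shows "Limsup at_top (\<lambda>\<theta>. ereal (1 / \<theta>) * log_prob (measure (P \<theta>) F)) \<le> ereal (- s)"
proof -
  have "0 \<le> r"
    using s by simp
  obtain n where n: "\<And>x. \<lbrakk>x \<in> F; \<And>i. x (Suc i) \<le> x i\<rbrakk> \<Longrightarrow> r < (\<Sum>i<n. x i)"
    using closed_partial_sum_gt[OF F \<open>0 \<le> r\<close> rate] by blast
  \<comment> \<open>\<open>Suc n\<close> avoids a zero denominator and still gives
    \<open>n * \<delta> \<le> r - s\<close>.\<close>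
  define \<delta> where "\<delta> = (r - s) / Suc n"
  have \<delta>: "0 < \<delta>"
    using s by (simp add: \<delta>_def)
  have "n * \<delta> \<le> Suc n * \<delta>"
    using \<delta> by (intro mult_right_mono) auto
  also have "\<dots> = r - s"
    by (simp add: \<delta>_def)
  finally have s_le: "s \<le> r - n * \<delta>"
    by simp
  obtain K where "r / \<delta> \<le> real K"
    using real_arch_simple by blast
  then have K: "r \<le> \<delta> * real K"
    using \<delta> by (simp add: pos_divide_le_eq mult.commute)
  define C where "C = (real (Suc K) * max 1 (1 / \<delta>)) ^ n"
  have C: "0 < C"
    by (auto simp: C_def less_max_iff_disj intro!: zero_less_power mult_pos_pos)
  have sets: "F \<in> sets (borel_of_topology nonneg_sequences)"
    using F by (rule closedin_in_sets_borel_of_topology)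
  show ?thesis
  proof (rule Limsup_log_prob_le[OF C])
    show "\<forall>\<^sub>F \<theta> in at_top. 0 \<le> measure (P \<theta>) F \<and> measure (P \<theta>) F \<le> C * exp (- \<theta> * s)"
      using eventually_gt_at_top[of 0]
    proof eventually_elim
      case (elim \<theta>)
      let ?E = "(\<lambda>\<omega> n. \<gamma> \<theta> n \<omega> / \<theta>) -` F \<inter> space (W \<theta>)"
      have "AE \<omega> in W \<theta>. \<omega> \<in> ?E \<longrightarrow> \<theta> * r < (\<Sum>i<n. \<gamma> \<theta> i \<omega>)"
        using enum[OF elim]
      proof eventually_elim
        case dec: (elim \<omega>)
        show ?case
        proof
          assume "\<omega> \<in> ?E"
          moreover have "\<gamma> \<theta> (Suc i) \<omega> / \<theta> \<le> \<gamma> \<theta> i \<omega> / \<theta>" for i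
            using dec elim by (intro divide_right_mono) (auto simp: less_imp_le)
          ultimately have "r < (\<Sum>i<n. \<gamma> \<theta> i \<omega> / \<theta>)"
            using n[of "\<lambda>i. \<gamma> \<theta> i \<omega> / \<theta>"] by simp
          then show "\<theta> * r < (\<Sum>i<n. \<gamma> \<theta> i \<omega>)"
            using elim by (simp add: sum_divide_distrib[symmetric] pos_less_divide_eq mult.commute)
        qed
      qed
      then have "measure (W \<theta>) ?E \<le> C * exp (- \<theta> * (r - n * \<delta>))"
        unfolding C_def
        by (intro poisson_top_sum_upper_bound[OF ppp[OF elim] elim enum[OF elim] \<delta> K]
            measurable_sets[OF scaled_measurable[OF elim] sets])
      also have "\<dots> \<le> C * exp (- \<theta> * s)"
        using mult_left_mono[OF s_le, of \<theta>] elim C by (intro mult_left_mono) auto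
      finally show ?case
        using measure_P[OF elim sets] by simp
    qed
  qed
qed

lemma Liminf_open_ge:
  assumes G: "openin nonneg_sequences G" and x: "x \<in> G" and s: "ordered_sum_rate x < ennreal s"
  shows "ereal (- s) \<le> Liminf at_top (\<lambda>\<theta>. ereal (1 / \<theta>) * log_prob (measure (P \<theta>) G))"
proof -
  have sets: "G \<in> sets (borel_of_topology nonneg_sequences)"
    using G by (rule openin_in_sets_borel_of_topology)
  obtain n \<epsilon> where \<epsilon>: "0 < \<epsilon>"
    and box: "\<forall>y. (\<forall>i. 0 \<le> y i) \<and> (\<forall>i<n. \<bar>y i - x i\<bar> < \<epsilon>) \<longrightarrow> y \<in> G"
    by (rule openin_nonneg_sequences_contains_box[OF G x])
  \<comment> \<open>The slack \<open>s - t\<close> is the budget for shifting the coordinates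
    upwards.\<close>
  obtain t where t: "0 \<le> t" "t < s" "ordered_sum_rate x \<le> ennreal t"
  proof (cases "ordered_sum_rate x")
    case (real t)
    then show ?thesis
      using s that[of t] by (simp add: ennreal_less_iff)
  qed (use s in simp)
  have x_dec: "x (Suc i) \<le> x i" and x_nonneg: "0 \<le> x i" and x_sum: "(\<Sum>i<k. x i) \<le> t" for i k
    using t(3) unfolding ordered_sum_rate_le_iff[OF t(1)] by blast+
  have x_anti: "x j \<le> x i" if "i \<le> j" for i j
    using that
  proof (induction rule: dec_induct)
    case (step k)
    then show ?case
      using x_dec[of k] by linarith
  qed simp
  \<comment> \<open>The largest shift below is \<open>2 * n * \<eta>\<close>. This choice keeps it
    smaller than \<epsilon>, as the box demands, and keeps the total of \<open>n\<close> shifts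
    within \<open>s - t\<close>.\<close>
  define \<eta> where "\<eta> = min \<epsilon> ((s - t) / Suc n) / (2 * Suc n)"
  have \<eta>: "0 < \<eta>"
    using \<epsilon> t by (simp add: \<eta>_def)
  have \<eta>_eq: "2 * Suc n * \<eta> = min \<epsilon> ((s - t) / Suc n)"
    by (simp add: \<eta>_def)
  have "2 * n * \<eta> < 2 * Suc n * \<eta>"
    using \<eta> by (intro mult_strict_right_mono) auto
  then have small: "2 * n * \<eta> < \<epsilon>" "2 * n * \<eta> \<le> (s - t) / Suc n"
    unfolding \<eta>_eq by auto
  \<comment> \<open>The shifts decrease with \<open>i\<close>, which makes the intervals disjoint even where \<open>x\<close> is constant.\<close>
  define b where "b i = x i + 2 * real (n - i) * \<eta>" for i
  define a where "a i = b i - \<eta>" for i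
  \<comment> \<open>Since \<open>n - i \<ge> 1\<close>, every left endpoint stays at or above
    \<eta>, even where \<open>x\<close> vanishes.\<close>
  have shift: "\<eta> \<le> 2 * real (n - i) * \<eta> - \<eta>" "2 * real (n - i) * \<eta> \<le> 2 * n * \<eta>" if "i < n" for i
  proof -
    have "2 * \<eta> \<le> 2 * real (n - i) * \<eta>"
      using that \<eta> by (intro mult_right_mono) auto
    then show "\<eta> \<le> 2 * real (n - i) * \<eta> - \<eta>"
      by simp
    show "2 * real (n - i) * \<eta> \<le> 2 * n * \<eta>"
      using \<eta> by (intro mult_right_mono) auto
  qed
  have ab: "\<eta> \<le> a i" "a i < b i" if "i < n" for i
    using shift(1)[OF that] x_nonneg[of i] \<eta> unfolding a_def b_def by linarith+
  have ba: "b j \<le> a i" if "i < j" "j < n" for i j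
  proof -
    \<comment> \<open>Shifts at different indices differ by at least \<open>2 * \<eta>\<close>,
      while an interval has width only \<eta>.\<close>
    have "2 * real (n - j) + 1 \<le> 2 * real (n - i)"
      using that by linarith
    then have "(2 * real (n - j) + 1) * \<eta> \<le> 2 * real (n - i) * \<eta>"
      using \<eta> by (intro mult_right_mono) auto
    then show ?thesis
      using x_anti[of i j] that by (simp add: a_def b_def algebra_simps)
  qed
  have "(\<Sum>i<n. b i) \<le> (\<Sum>i<n. x i) + n * (2 * n * \<eta>)"
    unfolding b_def sum.distrib using sum_bounded_above[of "{..<n}" _ "2 * n * \<eta>"] shift(2) by fastforce
  also have "n * (2 * n * \<eta>) \<le> Suc n * ((s - t) / Suc n)"
    using small(2) \<eta> by (intro mult_mono) auto
  also have "\<dots> = s - t"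
    by simp
  finally have b_sum: "(\<Sum>i<n. b i) \<le> s"
    using x_sum[of n] by simp
  define C where "C = (\<Prod>i<n. exp (- (1 / \<eta>)) * ((b i - a i) / b i)) * exp (- (1 / \<eta>))"
  have "0 < b i" if "i < n" for i
    using ab[OF that] \<eta> by linarith
  then have C: "0 < C"
    using ab(2) by (auto simp: C_def intro!: prod_pos mult_pos_pos)
  show ?thesis
  proof (rule Liminf_log_prob_ge[OF C])
    show "\<forall>\<^sub>F \<theta> in at_top. C * exp (- \<theta> * s) \<le> measure (P \<theta>) G"
      using eventually_ge_at_top[of 1]
    proof eventually_elim
      case (elim \<theta>)
      then have \<theta>: "0 < \<theta>"
        by simp
      let ?E = "(\<lambda>\<omega> n. \<gamma> \<theta> n \<omega> / \<theta>) -` G \<inter> space (W \<theta>)"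
      have "AE \<omega> in W \<theta>. (\<forall>i<n. \<gamma> \<theta> i \<omega> \<in> {\<theta> * a i<..\<theta> * b i}) \<longrightarrow> \<omega> \<in> ?E"
        using AE_space
      proof eventually_elim
        case \<omega>: (elim \<omega>)
        show ?case
        proof
          assume cells: "\<forall>i<n. \<gamma> \<theta> i \<omega> \<in> {\<theta> * a i<..\<theta> * b i}"
          have "(\<lambda>n. \<gamma> \<theta> n \<omega> / \<theta>) \<in> G"
          proof (intro box[rule_format] conjI allI impI)
            show "0 \<le> \<gamma> \<theta> i \<omega> / \<theta>" for i
              using \<gamma>_pos[OF \<theta> \<omega>, of i] \<theta> by simp
            fix i
            assume i: "i < n"
            then have "a i < \<gamma> \<theta> i \<omega> / \<theta>" "\<gamma> \<theta> i \<omega> / \<theta> \<le> b i"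
              using cells \<theta> by (auto simp: pos_less_divide_eq pos_divide_le_eq mult.commute)
            then show "\<bar>\<gamma> \<theta> i \<omega> / \<theta> - x i\<bar> < \<epsilon>"
              using shift[OF i] small(1) \<eta> unfolding a_def b_def by linarith
          qed
          then show "\<omega> \<in> ?E"
            using \<omega> by simp
        qed
      qed
      then have "C * exp (- \<theta> * (\<Sum>i<n. b i)) \<le> measure (W \<theta>) ?E"
        unfolding C_def
        by (intro poisson_top_points_lower_bound[OF ppp[OF \<theta>] elim enum[OF \<theta>] \<eta> ab ba]
            measurable_sets[OF scaled_measurable[OF \<theta>] sets])
      moreover have "C * exp (- \<theta> * s) \<le> C * exp (- \<theta> * (\<Sum>i<n. b i))"
        using mult_left_mono[OF b_sum, of \<theta>] \<theta> C by (intro mult_left_mono) auto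
      ultimately show ?case
        using measure_P[OF \<theta> sets] by simp
    qed
  qed
qed

section \<open>From bounds at real levels to infima over closed and open sets\<close>

lemma closed_upper_bound:
  assumes F: "closedin nonneg_sequences F"
  shows "Limsup at_top (\<lambda>\<theta>. ereal (1 / \<theta>) * log_prob (measure (P \<theta>) F))
    \<le> - enn2ereal (INF x\<in>F. ordered_sum_rate x)"
proof (rule ccontr)
  let ?L = "Limsup at_top (\<lambda>\<theta>. ereal (1 / \<theta>) * log_prob (measure (P \<theta>) F))"
  let ?I = "INF x\<in>F. ordered_sum_rate x"
  \<comment> \<open>The trivial bound from probabilities at most 1 forces the level \<open>s\<close>
    chosen below to be nonnegative, so that \<open>ennreal\<close> does not truncate it.\<close>
  have L_le: "?L \<le> ereal (- 0)"
  proof (rule Limsup_log_prob_le[of 1])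
    show "\<forall>\<^sub>F \<theta> in at_top. 0 \<le> measure (P \<theta>) F \<and> measure (P \<theta>) F \<le> 1 * exp (- \<theta> * 0)"
      using eventually_gt_at_top[of 0]
      by eventually_elim (simp add: prob_space.prob_le_1[OF prob_space_P])
  qed simp
  assume "\<not> ?L \<le> - enn2ereal ?I"
  then have "- ?L < enn2ereal ?I"
    by (simp add: not_le ereal_uminus_less_reorder)
  then obtain s where s: "- ?L < ereal s" "ereal s < enn2ereal ?I"
    using ereal_dense2 by blast
  \<comment> \<open>A second level supplies the strict gap that the discretization consumes. Working
    with real levels below the infimum also covers an infinite infimum, including empty
    \<open>F\<close>.\<close>
  from s(2) obtain r where r: "s < r" "ereal r < enn2ereal ?I"
    using ereal_dense2 by (metis ereal_less_eq(3) ereal_less(2) less_ereal.simps(1))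
  have "0 \<le> - ?L"
    using L_le by (simp add: ereal_uminus_le_reorder zero_ereal_def[symmetric])
  then have "0 \<le> s"
    using s(1) by (metis ereal_less(2) le_less_trans less_imp_le)
  have "ennreal r < ordered_sum_rate x" if "x \<in> F" for x
  proof -
    have "enn2ereal (ennreal r) < enn2ereal ?I"
      using r \<open>0 \<le> s\<close> by (simp add: enn2ereal_ennreal)
    then have "ennreal r < ?I"
      by (simp add: less_ennreal.rep_eq)
    then show ?thesis
      using INF_lower[OF that, of ordered_sum_rate] by (rule less_le_trans)
  qed
  from Limsup_closed_le[OF F \<open>0 \<le> s\<close> r(1) this] have "?L \<le> - ereal s"
    by simp
  moreover have "- ereal s < ?L"
    using s(1) ereal_uminus_less_reorder by blast
  ultimately show False
    using not_le by blast
qed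

lemma open_lower_bound:
  assumes G: "openin nonneg_sequences G"
  shows "- enn2ereal (INF x\<in>G. ordered_sum_rate x)
    \<le> Liminf at_top (\<lambda>\<theta>. ereal (1 / \<theta>) * log_prob (measure (P \<theta>) G))"
proof (rule ccontr)
  let ?L = "Liminf at_top (\<lambda>\<theta>. ereal (1 / \<theta>) * log_prob (measure (P \<theta>) G))"
  let ?I = "INF x\<in>G. ordered_sum_rate x"
  assume "\<not> - enn2ereal ?I \<le> ?L"
  \<comment> \<open>This strict inequality makes the infimum finite, so the infinite case is already
    excluded; a real level in between yields a point of \<open>G\<close> of smaller rate.\<close>
  then have "enn2ereal ?I < - ?L"
    by (simp add: not_le ereal_less_uminus_reorder)
  then obtain s where s: "enn2ereal ?I < ereal s" "ereal s < - ?L"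
    using ereal_dense2 by blast
  have "0 \<le> s"
    using le_less_trans[OF enn2ereal_nonneg s(1)] by simp
  then have "enn2ereal ?I < enn2ereal (ennreal s)"
    using s(1) by (simp add: enn2ereal_ennreal)
  then have "?I < ennreal s"
    by (simp add: less_ennreal.rep_eq)
  then obtain x where "x \<in> G" "ordered_sum_rate x < ennreal s"
    by (auto simp: INF_less_iff)
  from Liminf_open_ge[OF G this] have "- ereal s \<le> ?L"
    by simp
  then show False
    using s(2) by (metis ereal_uminus_le_reorder not_le)
qed

lemma large_deviation_principle_P: "large_deviation_principle nonneg_sequences P ordered_sum_rate"
  unfolding large_deviation_principle_def
proof (intro conjI allI impI)
  fix \<theta> :: real
  assume "0 < \<theta>"
  then show "prob_space (P \<theta>)"
    by (rule prob_space_P)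
  show "space (P \<theta>) = topspace nonneg_sequences"
    "sets (P \<theta>) = sets (borel_of_topology nonneg_sequences)"
    using \<open>0 < \<theta>\<close> by (simp_all add: P_eq space_borel_of_topology)
next
  show "rate_function nonneg_sequences ordered_sum_rate"
    using good_rate_function_ordered_sum_rate by (simp add: good_rate_function_def)
qed (fact closed_upper_bound open_lower_bound)+

end

theorem theorem3p1:
  fixes W :: "real \<Rightarrow> 'w measure"
    and \<Xi> :: "real \<Rightarrow> 'w \<Rightarrow> real set"
    and \<gamma> :: "real \<Rightarrow> nat \<Rightarrow> 'w \<Rightarrow> real"
    and P :: "real \<Rightarrow> (nat \<Rightarrow> real) measure"
  assumes "\<And>\<theta>. \<theta> > 0 \<Longrightarrow> poisson_point_process (W \<theta>) (gamma_mean_measure \<theta>) (\<Xi> \<theta>)"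
    and "\<And>\<theta> n. \<theta> > 0 \<Longrightarrow> \<gamma> \<theta> n \<in> measurable (W \<theta>) (restrict_space borel {0<..})"
    and "\<And>\<theta>. \<theta> > 0 \<Longrightarrow>
           AE \<omega> in W \<theta>. (\<forall>n. \<gamma> \<theta> (Suc n) \<omega> < \<gamma> \<theta> n \<omega>) \<and> range (\<lambda>n. \<gamma> \<theta> n \<omega>) = \<Xi> \<theta> \<omega>"
    and "\<And>\<theta>. \<theta> > 0 \<Longrightarrow>
           P \<theta> = distr (W \<theta>) (borel_of_topology nonneg_sequences) (\<lambda>\<omega> n. \<gamma> \<theta> n \<omega> / \<theta>)"
  shows "large_deviation_principle nonneg_sequences P ordered_sum_rate \<and>
         good_rate_function nonneg_sequences ordered_sum_rate"
proof -
  interpret poisson_enumeration W \<Xi> \<gamma> P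
    using assms by unfold_locales
  show ?thesis
    using large_deviation_principle_P good_rate_function_ordered_sum_rate by blast
qed

end
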